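(* Let $1/2<s<1$, let $f\in C^2(\mathbb{R})$ be a bistable nonlinearity with associated speed $k>0$ and one-dimensional profile $\Phi$, let $c>k$, and let $h$ be a pyramid function as in the context. Then $$v(x,y,z)=\Phi\left(\frac{k}{c}\,(z-h(x,y))\right)$$ is a sub-solution of $(-\Delta)^su-c\,u_z-f(u)=0$ in $\mathbb{R}^3$.
   Context: Fractional Laplacian: for $w\in C^2(\mathbb{R}^n)$ with $\int_{\mathbb{R}^n}\frac{|w(x)|}{(1+|x|)^{n+2s}}dx<\infty$, $(-\Delta)^sw(x)=C_{n,s}\,\mathrm{P.V.}\int_{\mathbb{R}^n}\frac{w(x)-w(x+\xi)}{|\xi|^{n+2s}}d\xi$ with $C_{n,s}=\frac{2^{2s}s\Gamma(\frac n2+s)}{\Gamma(1-s)\pi^{n/2}}$. For $n=1$ it is written $(-\partial^2)^s$. Bistable nonlinearity: $f\in C^2(\mathbb{R})$ and there is $t_0\in(-1,1)$ with $f(\pm1)=f(t_0)=0$, $f<0$ on $(-1,t_0)$, $f>0$ on $(t_0,1)$, $f'(\pm1)<0$. One-dimensional profile: $(k,\Phi)$ is the unique pair (known to exist by a result of Gui and Zhao), normalized by $\Phi(0)=0$, with $(-\partial^2)^s\Phi(\mu)-k\Phi'(\mu)-f(\Phi(\mu))=0$ and $\Phi'(\mu)<0$ for all $\mu\in\mathbb{R}$, and $\lim_{\mu\to\pm\infty}\Phi(\mu)=\mp1$. It is assumed that $k>0$; $\Phi$ is a classical ($C^2$) solution. Pyramid: $m_*=\sqrt{c^2-k^2}/k>0$,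 $N\ge3$ is an integer, and $(a_j,b_j)\in\mathbb{R}^2$, $1\le j\le N$, are pairwise distinct pairs with $a_j^2+b_j^2=m_*^2$ and $a_jb_{j+1}-a_{j+1}b_j>0$ for $1\le j\le N$, where $a_{N+1}=a_1$, $b_{N+1}=b_1$. Put $h_j(x,y)=a_jx+b_jy$ and $h=\max_{1\le j\le N}h_j$. Sub-solution: write $\mathcal{L}[u]=(-\Delta)^su-cu_z-f(u)$. A function $v\in C(\mathbb{R}^3)\cap L^\infty(\mathbb{R}^3)$ is a sub-solution if $v=\max_jv_j$ for finitely many $v_j\in C^2(\mathbb{R}^3)\cap L^\infty(\mathbb{R}^3)$ satisfying $\mathcal{L}[v_j]\le0$ in $\mathbb{R}^3$ for each $j$. *)

theory Defs
  imports "HOL-Analysis.Analysis"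
begin

definition C2_fun :: "('a::euclidean_space \<Rightarrow> real) \<Rightarrow> bool" where
  "C2_fun w \<longleftrightarrow>
     (\<exists>(w' :: 'a \<Rightarrow> 'a \<Rightarrow>\<^sub>L real) (w'' :: 'a \<Rightarrow> 'a \<Rightarrow>\<^sub>L ('a \<Rightarrow>\<^sub>L real)).
        (\<forall>x. (w has_derivative blinfun_apply (w' x)) (at x)) \<and>
        (\<forall>x. (w' has_derivative blinfun_apply (w'' x)) (at x)) \<and>
        continuous_on UNIV w'')"

definition frac_const :: "nat \<Rightarrow> real \<Rightarrow> real" where
  "frac_const n s =
     2 powr (2 * s) * s * Gamma (real n / 2 + s) / (Gamma (1 - s) * pi powr (real n / 2))"

(* The principal value is the limit of integrals over complements of balls around the origin.
   It exists when 0 < s < 1, w is C^2 and |w(x)| / (1 + |x|)^(n+2s) is integrable, in particular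
   when w is C^2 and bounded; outside such a class the value of this total function is not
   meaningful. *)
definition frac_laplacian :: "real \<Rightarrow> ('a::euclidean_space \<Rightarrow> real) \<Rightarrow> 'a \<Rightarrow> real" where
  "frac_laplacian s w x =
     frac_const DIM('a) s *
     Lim (at_right 0) (\<lambda>\<epsilon>. LINT \<xi>:{\<xi>. \<epsilon> \<le> norm \<xi>}|lborel.
                          (w x - w (x + \<xi>)) / norm \<xi> powr (real DIM('a) + 2 * s))"

definition bistable :: "(real \<Rightarrow> real) \<Rightarrow> bool" where
  "bistable f \<longleftrightarrow>
     C2_fun f \<and>
     (\<exists>t\<^sub>0. -1 < t\<^sub>0 \<and> t\<^sub>0 < 1 \<and>
        f (-1) = 0 \<and> f 1 = 0 \<and> f t\<^sub>0 = 0 \<and>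
        (\<forall>t. -1 < t \<and> t < t\<^sub>0 \<longrightarrow> f t < 0) \<and>
        (\<forall>t. t\<^sub>0 < t \<and> t < 1 \<longrightarrow> f t > 0)) \<and>
     deriv f (-1) < 0 \<and> deriv f 1 < 0"

definition profile :: "real \<Rightarrow> (real \<Rightarrow> real) \<Rightarrow> real \<Rightarrow> (real \<Rightarrow> real) \<Rightarrow> bool" where
  "profile s f k \<Phi> \<longleftrightarrow>
     C2_fun \<Phi> \<and> \<Phi> 0 = 0 \<and>
     (\<forall>\<mu>. frac_laplacian s \<Phi> \<mu> - k * deriv \<Phi> \<mu> - f (\<Phi> \<mu>) = 0) \<and>
     (\<forall>\<mu>. deriv \<Phi> \<mu> < 0) \<and>
     (\<Phi> \<longlongrightarrow> -1) at_top \<and> (\<Phi> \<longlongrightarrow> 1) at_bot"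

(* The indices are 1, ..., N; the entries at N + 1 repeat those at 1. *)
definition pyramid_data :: "real \<Rightarrow> nat \<Rightarrow> (nat \<Rightarrow> real) \<Rightarrow> (nat \<Rightarrow> real) \<Rightarrow> bool" where
  "pyramid_data m N a b \<longleftrightarrow>
     N \<ge> 3 \<and>
     inj_on (\<lambda>j. (a j, b j)) {1..N} \<and>
     (\<forall>j\<in>{1..N}. (a j)\<^sup>2 + (b j)\<^sup>2 = m\<^sup>2) \<and>
     a (N + 1) = a 1 \<and> b (N + 1) = b 1 \<and>
     (\<forall>j\<in>{1..N}. a j * b (j + 1) - a (j + 1) * b j > 0)"

definition pyramid :: "nat \<Rightarrow> (nat \<Rightarrow> real) \<Rightarrow> (nat \<Rightarrow> real) \<Rightarrow> real \<Rightarrow> real \<Rightarrow> real" where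
  "pyramid N a b x y = (MAX j\<in>{1..N}. a j * x + b j * y)"

definition travelling_op ::
    "real \<Rightarrow> real \<Rightarrow> (real \<Rightarrow> real) \<Rightarrow> (real^3 \<Rightarrow> real) \<Rightarrow> real^3 \<Rightarrow> real" where
  "travelling_op s c f u X =
     frac_laplacian s u X - c * frechet_derivative u (at X) (axis 3 1) - f (u X)"

(* For continuous functions, membership in L^infinity is boundedness of the range. *)
definition sub_solution ::
    "real \<Rightarrow> real \<Rightarrow> (real \<Rightarrow> real) \<Rightarrow> (real^3 \<Rightarrow> real) \<Rightarrow> bool" where
  "sub_solution s c f v \<longleftrightarrow>
     continuous_on UNIV v \<and> bounded (range v) \<and>
     (\<exists>V. finite V \<and> V \<noteq> {} \<and>
        (\<forall>w\<in>V. C2_fun w \<and> bounded (range w) \<and> (\<forall>X. travelling_op s c f w X \<le> 0)) \<and>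
        (\<forall>X. v X = (MAX w\<in>V. w X)))"

end

theory Submission
  imports Defs
begin

text \<open>
  Since \<open>\<Phi>\<close> is decreasing, \<open>\<Phi> (k / c * (z - h))\<close> is the maximum over \<open>j\<close> of
  \<open>\<Phi> (k / c * (z - h\<^sub>j))\<close>, and each of these functions is a plane wave \<open>\<Phi> (e\<^sub>j \<bullet> X)\<close>; the relation
  between \<open>c\<close>, \<open>k\<close> and the slopes makes \<open>e\<^sub>j\<close> a unit vector.  For a unit vector, the fractional
  Laplacian of a plane wave in space is the one-dimensional fractional Laplacian of its profile,
  so every plane wave solves the equation exactly.

  To compare the two principal values, integrate the kernel \<open>norm \<xi> powr (- 3 - 2 * s)\<close>, cut off to
  \<open>\<epsilon> \<le> norm \<xi>\<close>, over the planes orthogonal to \<open>e\<close>.  The result is a multiple of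
  \<open>max \<bar>t\<bar> \<epsilon> powr (- 1 - 2 * s)\<close> and not of the cut-off one-dimensional kernel.  After symmetrising
  in \<open>t\<close> the two regularisations have the same limit by dominated convergence, because the second
  difference of a bounded \<open>C\<^sup>2\<close> function is \<open>O(min (t\<^sup>2) 1)\<close>.
\<close>

section \<open>Slicing a truncated radial kernel\<close>

text \<open>Boxes determine the measure. The preimage of a box is its image under the inverse map,
  again orthogonal, and the volume of such an image is available for \<open>lebesgue\<close>. The
  computation therefore passes through the completion, which agrees with \<open>lborel\<close> on
  Borel sets.\<close>

lemma distr_lborel_orthogonal_transformation:
  fixes T :: "real^'n::{finite,wellorder} \<Rightarrow> real^'n::_"
  assumes T: "orthogonal_transformation T"
  shows "distr lborel borel T = lborel"
proof (rule lborel_eqI[symmetric])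
  have cont: "continuous_on UNIV T"
    using T by (simp add: linear_continuous_on linear_linear orthogonal_transformation_linear)
  then have meas [measurable]: "T \<in> borel_measurable borel"
    by (rule borel_measurable_continuous_onI)
  fix l u :: "real^'n::_"
  assume lu: "\<And>b. b \<in> Basis \<Longrightarrow> l \<bullet> b \<le> u \<bullet> b"
  have pre: "T -` box l u = inv T ` box l u"
    using orthogonal_transformation_bij[OF T] by (simp add: bij_vimage_eq_inv_image)
  have inv: "orthogonal_transformation (inv T)"
    by (rule orthogonal_transformation_inv[OF T])
  have box: "box l u \<in> lmeasurable" by simp
  have vm: "T -` box l u \<in> sets borel"
    using measurable_sets[OF meas, of "box l u"] by simp
  have "emeasure (distr lborel borel T) (box l u) = emeasure lborel (T -` box l u)"
    by (subst emeasure_distr) simp_all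
  also have "\<dots> = emeasure lebesgue (T -` box l u)"
    using vm by simp
  also have "\<dots> = emeasure lebesgue (inv T ` box l u)"
    by (simp only: pre)
  also have "\<dots> = ennreal (measure lebesgue (inv T ` box l u))"
    by (rule emeasure_eq_measure2[OF measurable_orthogonal_image[OF inv box]])
  also have "\<dots> = ennreal (measure lebesgue (box l u))"
    by (simp only: measure_orthogonal_image[OF inv box])
  also have "measure lebesgue (box l u) = prod ((\<bullet>) (u - l)) Basis"
    by (simp add: measure_completion measure_lborel_box[OF lu])
  finally show "emeasure (distr lborel borel T) (box l u) = ennreal (prod ((\<bullet>) (u - l)) Basis)" .
qed simp

text \<open>Fubini works on product types. The nesting pairs the first coordinate with a plane,
  which is the splitting needed for slicing, and the map preserves both norm and measure.\<close>

definition triple_vec :: "real \<times> real \<times> real \<Rightarrow> real^3"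
  where "triple_vec = (\<lambda>(x, y, z). vector [x, y, z])"

lemma continuous_triple_vec: "continuous_on UNIV triple_vec"
proof -
  have "continuous_on UNIV (\<lambda>p :: real \<times> real \<times> real.
      fst p *\<^sub>R axis 1 1 + fst (snd p) *\<^sub>R axis 2 1 + snd (snd p) *\<^sub>R axis 3 1 :: real^3)"
    by (intro continuous_intros)
  also have "(\<lambda>p :: real \<times> real \<times> real.
      fst p *\<^sub>R axis 1 1 + fst (snd p) *\<^sub>R axis 2 1 + snd (snd p) *\<^sub>R axis 3 1 :: real^3) = triple_vec"
    by (auto simp: triple_vec_def fun_eq_iff vec_eq_iff forall_3 axis_def)
  finally show ?thesis .
qed

lemma measurable_triple_vec [measurable]: "triple_vec \<in> borel_measurable borel"
  by (rule borel_measurable_continuous_onI[OF continuous_triple_vec])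

lemma norm_triple_vec [simp]: "norm (triple_vec p) = norm p"
proof -
  obtain x y z where p: "p = (x, y, z)" by (cases p)
  have "norm (triple_vec p) = sqrt (x\<^sup>2 + y\<^sup>2 + z\<^sup>2)"
    by (simp add: p triple_vec_def norm_vec_def L2_set_def sum_3)
  also have "\<dots> = norm p"
    unfolding p norm_Pair by (simp add: add.assoc)
  finally show ?thesis .
qed

lemma triple_vec_nth_1 [simp]: "triple_vec p $ 1 = fst p"
  by (simp add: triple_vec_def split: prod.splits)

lemma emeasure_lborel_Times:
  fixes A :: "'a::euclidean_space set" and B :: "'b::euclidean_space set"
  assumes "A \<in> sets borel" "B \<in> sets borel"
  shows "emeasure lborel (A \<times> B) = emeasure lborel A * emeasure lborel B"
proof -
  have "emeasure (lborel \<Otimes>\<^sub>M lborel) (A \<times> B) = emeasure lborel A * emeasure lborel B"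
    by (rule lborel.emeasure_pair_measure_Times) (simp_all add: assms)
  then show ?thesis unfolding lborel_prod .
qed

lemma distr_lborel_triple_vec: "distr lborel borel triple_vec = lborel"
proof (rule lborel_eqI[symmetric])
  fix l u :: "real^3"
  assume lu: "\<And>b. b \<in> Basis \<Longrightarrow> l \<bullet> b \<le> u \<bullet> b"
  have lu': "l $ i \<le> u $ i" for i
  proof -
    have "axis i 1 \<in> (Basis :: (real^3) set)"
      by (auto simp: Basis_vec_def)
    from lu[OF this] show ?thesis
      by (simp only: inner_axis inner_real_def mult_1_right)
  qed
  have pre: "triple_vec -` box l u = box (l $ 1) (u $ 1) \<times> box (l $ 2) (u $ 2) \<times> box (l $ 3) (u $ 3)"
    by (auto simp: triple_vec_def mem_box_cart forall_3 box_real)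
  have bas: "(Basis :: (real^3) set) = (\<lambda>i. axis i 1) ` UNIV"
    by (auto simp: Basis_vec_def)
  have inj: "inj (\<lambda>i. axis i 1 :: real^3)"
    by (auto simp: inj_def axis_eq_axis)
  have lborel_Ioo: "emeasure lborel (box (l $ i) (u $ i)) = ennreal ((u - l) $ i)" for i
    using lu'[of i] by (simp add: box_real)
  have nonneg: "0 \<le> (u - l) $ i" for i
    using lu'[of i] by simp
  have box_borel: "box x y \<in> sets borel" for x y :: real
    by simp
  have prod_UNIV_3: "prod g (UNIV :: 3 set) = g 1 * (g 2 * g 3)" for g :: "3 \<Rightarrow> real"
    unfolding UNIV_3 by simp
  have "emeasure (distr lborel borel triple_vec) (box l u) = emeasure lborel (triple_vec -` box l u)"
    by (simp add: emeasure_distr)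
  also have "\<dots> = emeasure lborel (box (l $ 1) (u $ 1)) *
      (emeasure lborel (box (l $ 2) (u $ 2)) * emeasure lborel (box (l $ 3) (u $ 3)))"
    unfolding pre by (simp only: emeasure_lborel_Times borel_Times box_borel)
  also have "\<dots> = ennreal ((u - l) $ 1 * ((u - l) $ 2 * (u - l) $ 3))"
    unfolding lborel_Ioo by (subst ennreal_mult, rule nonneg, intro mult_nonneg_nonneg nonneg)+ (rule refl)
  also have "(u - l) $ 1 * ((u - l) $ 2 * (u - l) $ 3) = prod ((\<bullet>) (u - l)) Basis"
    unfolding bas prod.reindex[OF inj] comp_def inner_axis inner_real_def mult_1_right
    by (rule prod_UNIV_3[symmetric])
  finally show "emeasure (distr lborel borel triple_vec) (box l u) = ennreal (prod ((\<bullet>) (u - l)) Basis)" .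
qed simp

section \<open>Integration of the kernel over planes\<close>

text \<open>The antiderivative is \<open>- (r powr (-p))\<close>. With \<open>m\<close> the norm of
  a point, the identity supplies the weights of a layer-cake decomposition of the power
  kernel.\<close>

lemma nn_integral_powr_tail:
  fixes p m r :: real
  assumes "p > 0" "m > 0"
  shows "(\<integral>\<^sup>+r. ennreal (p * r powr (-p - 1)) * indicator {m..} r \<partial>lborel) = ennreal (m powr (-p))"
proof -
  have "((\<lambda>r. - (r powr (-p))) \<longlongrightarrow> - 0) at_top"
    using assms by (intro tendsto_minus tendsto_neg_powr filterlim_ident) auto
  then have "(\<integral>\<^sup>+r. ennreal (p * r powr (-p - 1)) * indicator {m..} r \<partial>lborel) 
     = ennreal (- 0 - (- (m powr (-p))))"
    using assms
    by (intro nn_integral_FTC_atLeast) (auto intro!: derivative_eq_intros)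
  then show ?thesis by simp
qed

lemma nn_integral_annulus_layers:
  fixes p m :: real
  assumes "p > 2" "m > 0"
  shows "(\<integral>\<^sup>+r. ennreal (pi * (r\<^sup>2 - m\<^sup>2) * (p * r powr (-p - 1))) * indicator {m..} r \<partial>lborel)
    = ennreal (2 * pi / (p - 2) * m powr (2 - p))"
proof -
  \<comment> \<open>Expanding the integrand gives \<open>pi * (p * r powr (1 - p) - m\<^sup>2 * (p *
    r powr (-p - 1)))\<close>, and \<open>F\<close> is the termwise antiderivative. Since
    \<open>p > 2\<close>, both powers vanish at infinity.\<close>
  define F where "F = (\<lambda>r. pi * (- p / (p - 2) * r powr (2 - p) + m\<^sup>2 * r powr (-p)))"
  have lim: "(F \<longlongrightarrow> pi * (- p / (p - 2) * 0 + m\<^sup>2 * 0)) at_top"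
    unfolding F_def using assms
    by (intro tendsto_intros tendsto_neg_powr filterlim_ident) auto
  have der: "DERIV F r :> pi * (r\<^sup>2 - m\<^sup>2) * (p * r powr (-p - 1))" if "m \<le> r" for r
  proof -
    have r: "r > 0" using that assms by simp
    have sq: "r powr (1 - p) = r\<^sup>2 * r powr (- p - 1)"
      using r by (simp add: powr_add[symmetric] flip: powr_numeral)
    have "DERIV F r :> pi * (- p / (p - 2) * ((2 - p) * r powr (1 - p)) + m\<^sup>2 * (- p * r powr (- p - 1)))"
      unfolding F_def using r using assms by (auto intro!: derivative_eq_intros)
    moreover have "- p / (p - 2) * ((2 - p) * r powr (1 - p)) = p * r powr (1 - p)"
      using assms by (simp add: divide_simps) (simp add: algebra_simps)
    ultimately have "DERIV F r :> pi * (p * r powr (1 - p) + m\<^sup>2 * (- p * r powr (- p - 1)))"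
      by simp
    then show ?thesis
      by (simp add: sq algebra_simps)
  qed
  have "(\<integral>\<^sup>+r. ennreal (pi * (r\<^sup>2 - m\<^sup>2) * (p * r powr (-p - 1))) * indicator {m..} r \<partial>lborel)
     = ennreal (pi * (- p / (p - 2) * 0 + m\<^sup>2 * 0) - F m)"
    using assms by (intro nn_integral_FTC_atLeast der lim) (auto intro!: mult_nonneg_nonneg power_mono)
  also have "pi * (- p / (p - 2) * 0 + m\<^sup>2 * 0) - F m = 2 * pi / (p - 2) * m powr (2 - p)"
  proof -
    have "m powr (2 - p) = m\<^sup>2 * m powr (- p)"
      using assms by (simp add: powr_add[symmetric] flip: powr_numeral)
    then show ?thesis using assms by (simp add: F_def field_simps)
  qed
  finally show ?thesis .
qed

text \<open>By Pythagoras the plane at height \<open>t\<close> meets the shell in a disc of squared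
  radius \<open>r\<^sup>2 - t\<^sup>2\<close>, with a hole of squared radius
  \<open>\<epsilon>\<^sup>2 - t\<^sup>2\<close> if \<bar>t\<bar> \<le> \<epsilon>. With a hole, the
  terms in \<open>t\<close> cancel in the area; without one, they remain. The maximum of
  \<bar>t\<bar> and \<epsilon> records both cases.\<close>

lemma emeasure_planar_annulus_slice:
  fixes t \<epsilon> r :: real
  assumes "\<epsilon> > 0" "r \<ge> \<epsilon>"
  shows "emeasure lborel {y :: real \<times> real. \<epsilon> \<le> norm (t, y) \<and> norm (t, y) \<le> r}
    = (if r \<ge> max \<bar>t\<bar> \<epsilon> then ennreal (pi * (r\<^sup>2 - (max \<bar>t\<bar> \<epsilon>)\<^sup>2)) else 0)"
proof (cases "\<bar>t\<bar> \<le> r")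
  case False
  have "{y :: real \<times> real. \<epsilon> \<le> norm (t, y) \<and> norm (t, y) \<le> r} = {}"
    using False norm_fst_le[of t] by (fastforce dest: order_trans)
  then show ?thesis using False by (simp only: emeasure_empty) simp
next
  case True
  have t2: "t\<^sup>2 \<le> r\<^sup>2" using True by (metis abs_ge_zero power2_abs power_mono)
  have le: "norm (t, y) \<le> r \<longleftrightarrow> norm y \<le> sqrt (r\<^sup>2 - t\<^sup>2)" for y :: "real \<times> real"
  proof -
    have "norm (t, y) \<le> r \<longleftrightarrow> sqrt (t\<^sup>2 + (norm y)\<^sup>2) \<le> sqrt (r\<^sup>2)"
      using assms by (simp add: norm_Pair)
    also have "\<dots> \<longleftrightarrow> (norm y)\<^sup>2 \<le> r\<^sup>2 - t\<^sup>2"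
      unfolding real_sqrt_le_iff by linarith
    also have "\<dots> \<longleftrightarrow> sqrt ((norm y)\<^sup>2) \<le> sqrt (r\<^sup>2 - t\<^sup>2)"
      by (rule real_sqrt_le_iff[symmetric])
    also have "sqrt ((norm y)\<^sup>2) = norm y"
      by simp
    finally show ?thesis .
  qed
  have area: "emeasure lborel (cball (0 :: real \<times> real) \<rho>) = ennreal (pi * \<rho>\<^sup>2)"
     "emeasure lborel (ball (0 :: real \<times> real) \<rho>) = ennreal (pi * \<rho>\<^sup>2)" if "\<rho> \<ge> 0" for \<rho>
    using that by (simp_all add: emeasure_cball emeasure_ball unit_ball_vol_2 power2_eq_square)
  show ?thesis
  proof (cases "\<bar>t\<bar> \<le> \<epsilon>")
    case far: False
    have "\<epsilon> \<le> norm (t, y)" for y :: "real \<times> real"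
      using far norm_fst_le[of t y] by simp
    then have "{y :: real \<times> real. \<epsilon> \<le> norm (t, y) \<and> norm (t, y) \<le> r} = cball 0 (sqrt (r\<^sup>2 - t\<^sup>2))"
      by (auto simp: le)
    then show ?thesis using far True t2 by (simp add: area max_def)
  next
    case near: True
    have t3: "t\<^sup>2 \<le> \<epsilon>\<^sup>2" using near by (metis abs_ge_zero power2_abs power_mono)
    have er: "\<epsilon>\<^sup>2 \<le> r\<^sup>2" using assms by (simp add: power_mono)
    have ge: "\<epsilon> \<le> norm (t, y) \<longleftrightarrow> \<not> norm y < sqrt (\<epsilon>\<^sup>2 - t\<^sup>2)" for y :: "real \<times> real"
    proof -
      have "\<epsilon> \<le> norm (t, y) \<longleftrightarrow> sqrt (\<epsilon>\<^sup>2) \<le> sqrt (t\<^sup>2 + (norm y)\<^sup>2)"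
        using assms by (simp add: norm_Pair)
      also have "\<dots> \<longleftrightarrow> \<epsilon>\<^sup>2 - t\<^sup>2 \<le> (norm y)\<^sup>2"
        unfolding real_sqrt_le_iff by linarith
      also have "\<dots> \<longleftrightarrow> sqrt (\<epsilon>\<^sup>2 - t\<^sup>2) \<le> sqrt ((norm y)\<^sup>2)"
        by (rule real_sqrt_le_iff[symmetric])
      also have "sqrt ((norm y)\<^sup>2) = norm y"
        by simp
      finally show ?thesis by linarith
    qed
    have "{y :: real \<times> real. \<epsilon> \<le> norm (t, y) \<and> norm (t, y) \<le> r}
        = cball 0 (sqrt (r\<^sup>2 - t\<^sup>2)) - ball 0 (sqrt (\<epsilon>\<^sup>2 - t\<^sup>2))"
      by (auto simp: le ge)
    moreover have "ball (0 :: real \<times> real) (sqrt (\<epsilon>\<^sup>2 - t\<^sup>2)) \<subseteq> cball 0 (sqrt (r\<^sup>2 - t\<^sup>2))"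
      using er by (intro subset_trans[OF ball_subset_cball] subset_cball) simp
    ultimately have "emeasure lborel {y :: real \<times> real. \<epsilon> \<le> norm (t, y) \<and> norm (t, y) \<le> r}
        = emeasure lborel (cball (0 :: real \<times> real) (sqrt (r\<^sup>2 - t\<^sup>2)))
          - emeasure lborel (ball (0 :: real \<times> real) (sqrt (\<epsilon>\<^sup>2 - t\<^sup>2)))"
      using emeasure_lborel_ball_finite[of "0 :: real \<times> real"]
      by (simp add: emeasure_Diff less_top)
    also have "\<dots> = ennreal (pi * (r\<^sup>2 - t\<^sup>2)) - ennreal (pi * (\<epsilon>\<^sup>2 - t\<^sup>2))"
      using t2 t3 by (simp add: area)
    also have "\<dots> = ennreal (pi * (r\<^sup>2 - \<epsilon>\<^sup>2))"
      using t3 by (subst ennreal_minus) (auto simp: algebra_simps)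
    finally show ?thesis using near assms by (simp add: max_def)
  qed
qed

lemma nn_integral_powr_slice:
  fixes t \<epsilon> p :: real
  assumes \<epsilon>: "\<epsilon> > 0" and p: "p > 2"
  shows "(\<integral>\<^sup>+y. ennreal (indicator {y. \<epsilon> \<le> norm (t, y)} y * norm (t, y :: real \<times> real) powr (-p)) \<partial>lborel)
    = ennreal (2 * pi / (p - 2) * max \<bar>t\<bar> \<epsilon> powr (2 - p))"
proof -
  let ?w = "\<lambda>r. ennreal (p * r powr (-p - 1))"
  let ?I = "\<lambda>y r. indicator {y. \<epsilon> \<le> norm (t, y)} (y :: real \<times> real) * (?w r * indicator {norm (t, y)..} r)"
  \<comment> \<open>Layer cake: the kernel is a superposition of indicator functions of balls, so only areas of
    planar annuli are needed.\<close>
  have layer: "ennreal (indicator {y. \<epsilon> \<le> norm (t, y)} y * norm (t, y) powr (-p))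
      = (\<integral>\<^sup>+r. ?I y r \<partial>lborel)" for y :: "real \<times> real"
  proof (cases "\<epsilon> \<le> norm (t, y)")
    case True
    with \<epsilon> have "norm (t, y) > 0" by linarith
    then show ?thesis
      using nn_integral_powr_tail[of p "norm (t, y)"] p True by simp
  qed simp
  have [measurable]: "(\<lambda>q. norm (t, fst q)) \<in> borel_measurable (lborel \<Otimes>\<^sub>M lborel :: ((real \<times> real) \<times> real) measure)"
    by (simp add: lborel_prod) (intro borel_measurable_continuous_onI continuous_intros)
  have Ialt: "?I y r = (if \<epsilon> \<le> norm (t, y) \<and> norm (t, y) \<le> r then ?w r else 0)" for y r
    by (simp add: indicator_def)
  have "(\<integral>\<^sup>+y. ennreal (indicator {y. \<epsilon> \<le> norm (t, y)} y * norm (t, y :: real \<times> real) powr (-p)) \<partial>lborel)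
     = (\<integral>\<^sup>+y. \<integral>\<^sup>+r. (if \<epsilon> \<le> norm (t, y) \<and> norm (t, y :: real \<times> real) \<le> r then ?w r else 0) \<partial>lborel \<partial>lborel)"
    by (simp only: layer Ialt)
  also have "\<dots> = (\<integral>\<^sup>+r. \<integral>\<^sup>+y. (if \<epsilon> \<le> norm (t, y) \<and> norm (t, y :: real \<times> real) \<le> r then ?w r else 0) \<partial>lborel \<partial>lborel)"
    by (rule lborel_pair.Fubini'[symmetric]) (simp add: case_prod_beta)
  also have "\<dots> = (\<integral>\<^sup>+r. ennreal (pi * (r\<^sup>2 - (max \<bar>t\<bar> \<epsilon>)\<^sup>2) * (p * r powr (-p - 1))) * indicator {max \<bar>t\<bar> \<epsilon>..} r \<partial>lborel)"
  proof (rule nn_integral_cong)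
    fix r :: real
    let ?A = "{y :: real \<times> real. \<epsilon> \<le> norm (t, y) \<and> norm (t, y) \<le> r}"
    have A: "?A \<in> sets borel"
      by measurable
    have "(\<integral>\<^sup>+y. (if \<epsilon> \<le> norm (t, y) \<and> norm (t, y :: real \<times> real) \<le> r then ?w r else 0) \<partial>lborel)
        = (\<integral>\<^sup>+y. ?w r * indicator ?A y \<partial>lborel)"
      by (intro nn_integral_cong) (simp add: indicator_def)
    also have "\<dots> = ?w r * emeasure lborel ?A"
      using A by (simp add: nn_integral_cmult_indicator)
    also have "\<dots> = ennreal (pi * (r\<^sup>2 - (max \<bar>t\<bar> \<epsilon>)\<^sup>2) * (p * r powr (-p - 1))) * indicator {max \<bar>t\<bar> \<epsilon>..} r"
    proof (cases "r \<ge> max \<bar>t\<bar> \<epsilon>")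
      case True
      then have "(max \<bar>t\<bar> \<epsilon>)\<^sup>2 \<le> r\<^sup>2" using \<epsilon> by (intro power_mono) auto
      then show ?thesis
        using True emeasure_planar_annulus_slice[OF \<epsilon>, of r t] p
        by (simp add: ennreal_mult' [symmetric] mult_ac)
    next
      case False
      \<comment> \<open>The area formula presupposes \<epsilon> \<le> r. Below \<epsilon> the slice
        is empty for a different reason: the lower cut-off exceeds the upper one.\<close>
      show ?thesis
      proof (cases "r \<ge> \<epsilon>")
        case True
        then show ?thesis using False emeasure_planar_annulus_slice[OF \<epsilon>, of r t] by simp
      next
        case r: False
        then have "?A = {}" by auto
        then show ?thesis using False by (simp only: emeasure_empty) simp
      qed
    qed
    finally show "(\<integral>\<^sup>+y. (if \<epsilon> \<le> norm (t, y) \<and> norm (t, y :: real \<times> real) \<le> r then ?w r else 0) \<partial>lborel)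
      = ennreal (pi * (r\<^sup>2 - (max \<bar>t\<bar> \<epsilon>)\<^sup>2) * (p * r powr (-p - 1))) * indicator {max \<bar>t\<bar> \<epsilon>..} r" .
  qed
  also have "\<dots> = ennreal (2 * pi / (p - 2) * max \<bar>t\<bar> \<epsilon> powr (2 - p))"
    using \<epsilon> p by (intro nn_integral_annulus_layers) auto
  finally show ?thesis .
qed

section \<open>Projection of the truncated kernel onto a line\<close>

text \<open>A rotation makes \<open>e\<close> the first axis without changing the radial density;
  Tonelli then leaves the planar integral at each height. Stating this for measures confines the
  computation to nonnegative integrands and lets it be applied to any signed measurable function of
  \<open>e \<bullet> \<xi>\<close>.\<close>

lemma distr_powr_density_inner:
  fixes e :: "real^3" and \<epsilon> p :: real
  assumes e: "norm e = 1" and \<epsilon>: "\<epsilon> > 0" and p: "p > 2"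
  shows "distr (density lborel (\<lambda>\<xi>. ennreal (indicator {\<xi>. \<epsilon> \<le> norm \<xi>} \<xi> * norm \<xi> powr (-p)))) borel (\<lambda>\<xi>. e \<bullet> \<xi>)
    = density lborel (\<lambda>t. ennreal (2 * pi / (p - 2) * max \<bar>t\<bar> \<epsilon> powr (2 - p)))"
proof (rule measure_eqI)
  let ?w = "\<lambda>x. ennreal (indicator {\<xi>. \<epsilon> \<le> norm \<xi>} x * norm x powr (-p))"
  obtain T where T: "orthogonal_transformation T" and Te: "T (axis 1 1 :: real^3) = e"
    using orthogonal_transformation_exists[of "axis 1 1" e] e by auto
  have [measurable]: "T \<in> borel_measurable borel"
    using T by (intro borel_measurable_continuous_onI) (simp add: linear_continuous_on linear_linear orthogonal_transformation_linear)
  have nT [simp]: "norm (T x) = norm x" for x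
    using T by (rule orthogonal_transformation_norm)
  have eT: "e \<bullet> T x = x $ 1" for x
    using T by (simp add: orthogonal_transformation_def Te[symmetric] inner_axis')
  fix B assume "B \<in> sets (distr (density lborel ?w) borel (\<lambda>\<xi>. e \<bullet> \<xi>))"
  then have B [measurable]: "B \<in> sets borel" by simp
  have wm [measurable]: "(\<lambda>x :: real^3. ?w x) \<in> borel_measurable borel"
    by measurable
  have "emeasure (distr (density lborel ?w) borel (\<lambda>\<xi>. e \<bullet> \<xi>)) B
      = (\<integral>\<^sup>+\<xi>. ?w (\<xi> :: real^3) * indicator B (e \<bullet> \<xi>) \<partial>lborel)"
    by (simp add: emeasure_distr emeasure_density indicator_def vimage_def)
  also have "\<dots> = (\<integral>\<^sup>+\<xi>. ?w (\<xi> :: real^3) * indicator B (e \<bullet> \<xi>) \<partial>(distr lborel borel T))"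
    by (simp add: distr_lborel_orthogonal_transformation[OF T])
  also have "\<dots> = (\<integral>\<^sup>+\<xi>. ?w (\<xi> :: real^3) * indicator B (\<xi> $ 1) \<partial>lborel)"
    by (subst nn_integral_distr) (simp_all add: eT indicator_def)
  also have "\<dots> = (\<integral>\<^sup>+\<xi>. ?w (\<xi> :: real^3) * indicator B (\<xi> $ 1) \<partial>(distr lborel borel triple_vec))"
    by (simp add: distr_lborel_triple_vec)
  also have "\<dots> = (\<integral>\<^sup>+q. ?w (q :: real \<times> real \<times> real) * indicator B (fst q) \<partial>lborel)"
    by (subst nn_integral_distr) (simp_all add: indicator_def)
  also have "\<dots> = (\<integral>\<^sup>+t. \<integral>\<^sup>+y. ?w (t, y :: real \<times> real) * indicator B t \<partial>lborel \<partial>lborel)"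
  proof -
    have [measurable]: "(fst :: real \<times> real \<times> real \<Rightarrow> real) \<in> borel_measurable borel"
      by (intro borel_measurable_continuous_onI continuous_intros)
    have "(\<lambda>q :: real \<times> real \<times> real. ?w q * indicator B (fst q)) \<in> borel_measurable (lborel \<Otimes>\<^sub>M lborel)"
      unfolding lborel_prod measurable_lborel1 by measurable
    from lborel.nn_integral_fst[OF this] show ?thesis
      unfolding lborel_prod fst_conv by (rule sym)
  qed
  also have "\<dots> = (\<integral>\<^sup>+t. ennreal (2 * pi / (p - 2) * max \<bar>t\<bar> \<epsilon> powr (2 - p)) * indicator B t \<partial>lborel)"
  proof (rule nn_integral_cong)
    fix t :: real
    have "(\<integral>\<^sup>+y. ?w (t, y :: real \<times> real) * indicator B t \<partial>lborel) = (\<integral>\<^sup>+y. ?w (t, y :: real \<times> real) \<partial>lborel) * indicator B t"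
      by (rule nn_integral_multc) measurable
    then show "(\<integral>\<^sup>+y. ?w (t, y :: real \<times> real) * indicator B t \<partial>lborel) = ennreal (2 * pi / (p - 2) * max \<bar>t\<bar> \<epsilon> powr (2 - p)) * indicator B t"
      using nn_integral_powr_slice[OF \<epsilon> p, of t] by (simp add: indicator_def)
  qed
  also have "\<dots> = emeasure (density lborel (\<lambda>t. ennreal (2 * pi / (p - 2) * max \<bar>t\<bar> \<epsilon> powr (2 - p)))) B"
    by (simp add: emeasure_density)
  finally show "emeasure (distr (density lborel ?w) borel (\<lambda>\<xi>. e \<bullet> \<xi>)) B
      = emeasure (density lborel (\<lambda>t. ennreal (2 * pi / (p - 2) * max \<bar>t\<bar> \<epsilon> powr (2 - p)))) B" .
qed simp

text \<open>Change of density and push-forward are identities for Bochner integrals even when the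
  integrand is not integrable, so measurability of \<open>g\<close> suffices.\<close>

lemma ridge_truncated_integral:
  fixes e :: "real^3" and \<epsilon> p :: real and g :: "real \<Rightarrow> real"
  assumes e: "norm e = 1" and \<epsilon>: "\<epsilon> > 0" and p: "p > 2" and g [measurable]: "g \<in> borel_measurable borel"
  shows "(LINT \<xi>:{\<xi>. \<epsilon> \<le> norm \<xi>}|lborel. g (e \<bullet> \<xi>) / norm \<xi> powr p)
    = 2 * pi / (p - 2) * (LINT t|lborel. max \<bar>t\<bar> \<epsilon> powr (2 - p) * g t)"
proof -
  let ?w = "\<lambda>\<xi> :: real^3. indicator {\<xi>. \<epsilon> \<le> norm \<xi>} \<xi> * norm \<xi> powr (-p)"
  have "(LINT \<xi>:{\<xi>. \<epsilon> \<le> norm \<xi>}|lborel. g (e \<bullet> \<xi>) / norm \<xi> powr p)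
      = (LINT \<xi>|lborel. ?w \<xi> *\<^sub>R g (e \<bullet> \<xi>))"
    unfolding set_lebesgue_integral_def
    by (intro Bochner_Integration.integral_cong) (auto simp: powr_minus divide_inverse)
  also have "\<dots> = (LINT \<xi>|density lborel ?w. g (e \<bullet> \<xi>))"
    by (rule integral_density[symmetric]) auto
  also have "\<dots> = (LINT t|distr (density lborel ?w) borel (\<lambda>\<xi>. e \<bullet> \<xi>). g t)"
    by (rule integral_distr[symmetric]) auto
  also have "\<dots> = (LINT t|density lborel (\<lambda>t. 2 * pi / (p - 2) * max \<bar>t\<bar> \<epsilon> powr (2 - p)). g t)"
    by (simp only: distr_powr_density_inner[OF e \<epsilon> p])
  also have "\<dots> = (LINT t|lborel. (2 * pi / (p - 2) * max \<bar>t\<bar> \<epsilon> powr (2 - p)) *\<^sub>R g t)"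
    using p by (intro integral_density) auto
  also have "\<dots> = (LINT t|lborel. 2 * pi / (p - 2) * (max \<bar>t\<bar> \<epsilon> powr (2 - p) * g t))"
    by (simp add: mult.assoc)
  also have "\<dots> = 2 * pi / (p - 2) * (LINT t|lborel. max \<bar>t\<bar> \<epsilon> powr (2 - p) * g t)"
    by (rule integral_mult_right_zero)
  finally show ?thesis .
qed

section \<open>Principal values on the line\<close>

text \<open>Adding the reflected half-line function gives the even extension. The open half-lines
  miss the origin, so \<open>g 0 = 0\<close> makes the identity hold at every point.\<close>

lemma integrable_even:
  fixes g :: "real \<Rightarrow> real"
  assumes g: "integrable lborel (\<lambda>t. indicator {0<..} t * g t)" and "g 0 = 0"
  shows "integrable lborel (\<lambda>t. g \<bar>t\<bar>)"
proof -
  have "integrable lborel (\<lambda>t. indicator {0<..} (0 + -1 * t) * g (0 + -1 * t))"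
    by (rule lborel_integrable_real_affine[OF g]) simp
  from Bochner_Integration.integrable_add[OF g this]
  have "integrable lborel (\<lambda>t. indicator {0<..} t * g t + indicator {0<..} (-t) * g (-t))"
    by simp
  also have "(\<lambda>t. indicator {0<..} t * g t + indicator {0<..} (-t) * g (-t)) = (\<lambda>t. g \<bar>t\<bar>)"
    using \<open>g 0 = 0\<close> by (auto simp: fun_eq_iff indicator_def abs_if)
  finally show ?thesis .
qed

lemma integrable_powr_near_0:
  fixes a c :: real
  assumes "a > -1" "c \<ge> 0"
  shows "integrable lborel (\<lambda>t. indicator {0..c} t * t powr a)"
proof -
  have "(\<lambda>t. t powr a) absolutely_integrable_on {0..c}"
    using integrable_on_powr_from_0[OF assms] by (subst absolutely_integrable_on_iff_nonneg) auto
  then show ?thesis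
    unfolding set_integrable_def by (subst (asm) integrable_completion) auto
qed

lemma integrable_powr_tail:
  fixes a q :: real
  assumes "q > 1" "a > 0"
  shows "integrable lborel (\<lambda>t. indicator {a..} t * t powr (-q))"
proof -
  have "(\<lambda>t. t powr (-q)) integrable_on {a..}"
    using has_integral_powr_to_inf[of "-q" a] assms by (auto simp: integrable_on_def)
  then have "(\<lambda>t. t powr (-q)) absolutely_integrable_on {a..}"
    by (subst absolutely_integrable_on_iff_nonneg) auto
  then show ?thesis
    unfolding set_integrable_def by (subst (asm) integrable_completion) auto
qed

text \<open>This is the dominating function for second differences. Near the origin it is the power
  \<open>2 - q\<close>, integrable because \<open>q < 3\<close>; beyond 1 it is the power
  \<open>-q\<close>, integrable because \<open>q > 1\<close>.\<close>

lemma integrable_min_square_powr: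
  fixes q :: real
  assumes "1 < q" "q < 3"
  shows "integrable lborel (\<lambda>t. \<bar>t\<bar> powr (-q) * min (t\<^sup>2) 1)"
proof -
  have "integrable lborel (\<lambda>t. indicator {0<..} t * (t powr (-q) * min (t\<^sup>2) 1))"
  proof (rule Bochner_Integration.integrable_bound)
    show "integrable lborel (\<lambda>t. indicator {0..1} t * t powr (2 - q) + indicator {1..} t * t powr (-q))"
      using assms by (intro Bochner_Integration.integrable_add integrable_powr_near_0 integrable_powr_tail) auto
    show "AE t in lborel. norm (indicator {0<..} t * (t powr (-q) * min (t\<^sup>2) 1))
      \<le> norm (indicator {0..1} t * t powr (2 - q) + indicator {1..} t * t powr (-q))"
    proof (rule AE_I2)
      fix t :: real
      consider "t \<le> 0" | "0 < t" "t \<le> 1" | "t > 1" by linarith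
      then show "norm (indicator {0<..} t * (t powr (-q) * min (t\<^sup>2) 1))
        \<le> norm (indicator {0..1} t * t powr (2 - q) + indicator {1..} t * t powr (-q))"
      proof cases
        case 2
        have "t powr (2 - q) = t powr (-q) * t\<^sup>2"
          using 2 by (simp add: powr_add[symmetric] flip: powr_numeral)
        moreover have "t\<^sup>2 \<le> 1" using 2 by (simp add: power_le_one)
        ultimately show ?thesis using 2 by (simp add: abs_mult min_def indicator_def)
      next
        case 3
        then have "t\<^sup>2 \<ge> 1" by simp
        then show ?thesis using 3 by (simp add: abs_mult min_def)
      qed simp
    qed
  qed measurable
  then have "integrable lborel (\<lambda>t. \<bar>t\<bar> powr (-q) * min (\<bar>t\<bar>\<^sup>2) 1)"
    by (rule integrable_even) simp
  then show ?thesis by simp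
qed

lemma integrable_truncated_powr:
  fixes q \<epsilon> :: real
  assumes "q > 1" "\<epsilon> > 0"
  shows "integrable lborel (\<lambda>t. indicator {t. \<epsilon> \<le> \<bar>t\<bar>} t * \<bar>t\<bar> powr (-q))"
proof -
  have "integrable lborel (\<lambda>t. indicator {0<..} t * (indicator {\<epsilon>..} t * t powr (-q)))"
  proof (rule Bochner_Integration.integrable_bound[OF integrable_powr_tail[OF assms]])
  qed (auto simp: indicator_def)
  then have "integrable lborel (\<lambda>t. indicator {\<epsilon>..} \<bar>t\<bar> * \<bar>t\<bar> powr (-q))"
    by (rule integrable_even) simp
  then show ?thesis
    by (simp add: indicator_def)
qed

lemma integrable_max_powr:
  fixes q \<epsilon> :: real
  assumes "q > 1" "\<epsilon> > 0"
  shows "integrable lborel (\<lambda>t. max \<bar>t\<bar> \<epsilon> powr (-q))"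
proof (rule Bochner_Integration.integrable_bound)
  show "integrable lborel (\<lambda>t. \<epsilon> powr (-q) * indicator {-\<epsilon>..\<epsilon>} t + indicator {t. \<epsilon> \<le> \<bar>t\<bar>} t * \<bar>t\<bar> powr (-q))"
    using assms by (intro Bochner_Integration.integrable_add integrable_truncated_powr
        integrable_mult_right integrable_real_indicator) auto
  show "AE t in lborel. norm (max \<bar>t\<bar> \<epsilon> powr (-q))
      \<le> norm (\<epsilon> powr (-q) * indicator {-\<epsilon>..\<epsilon>} t + indicator {t. \<epsilon> \<le> \<bar>t\<bar>} t * \<bar>t\<bar> powr (-q))"
    by (rule AE_I2) (auto simp: indicator_def max_def)
qed measurable

section \<open>Symmetrisation and the limit of regularised integrals\<close>

text \<open>Averaging the integral with its reflection replaces a first difference, in general only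
  linear near the origin, by a second difference, which is quadratic there.\<close>

lemma integral_even_weight:
  fixes W D :: "real \<Rightarrow> real"
  assumes even: "\<And>t. W (-t) = W t" and int: "integrable lborel (\<lambda>t. W t * D t)"
  shows "(LINT t|lborel. W t * D t) = (LINT t|lborel. W t * (D t + D (-t))) / 2"
proof -
  have "integrable lborel (\<lambda>t. W (0 + -1 * t) * D (0 + -1 * t))"
    by (rule lborel_integrable_real_affine[OF int]) simp
  then have int': "integrable lborel (\<lambda>t. W t * D (-t))"
    by (simp add: even)
  have "(LINT t|lborel. W t * D t) = (LINT t|lborel. W t * D (-t))"
    by (subst lborel_integral_real_affine[of "-1" _ 0]) (simp_all add: even)
  then show ?thesis
    by (simp add: distrib_left Bochner_Integration.integral_add[OF int int'])
qed

text \<open>The family \<open>W\<close> is left abstract to cover both the sharp cut-off and the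
  kernel frozen at \<epsilon>. For fixed nonzero \<open>t\<close> the weight equals the full power
  once \<epsilon> \<le> \<bar>t\<bar>, and the bounds on \<open>W\<close> and on the symmetrised
  \<open>D\<close> give a common integrable majorant.\<close>

lemma tendsto_regularised_integral:
  fixes W :: "real \<Rightarrow> real \<Rightarrow> real" and D :: "real \<Rightarrow> real" and q B M :: real
  assumes q: "1 < q" "q < 3"
    and D [measurable]: "D \<in> borel_measurable borel" and M: "\<And>t. \<bar>D t\<bar> \<le> M"
    and B: "\<And>t. \<bar>D t + D (-t)\<bar> \<le> B * min (t\<^sup>2) 1"
    and W [measurable]: "\<And>\<epsilon>. W \<epsilon> \<in> borel_measurable borel"
    and even: "\<And>\<epsilon> t. W \<epsilon> (-t) = W \<epsilon> t"
    and int: "\<And>\<epsilon>. \<epsilon> > 0 \<Longrightarrow> integrable lborel (W \<epsilon>)"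
    and bound: "\<And>\<epsilon> t. \<epsilon> > 0 \<Longrightarrow> t \<noteq> 0 \<Longrightarrow> \<bar>W \<epsilon> t\<bar> \<le> \<bar>t\<bar> powr (-q)"
    and exact: "\<And>\<epsilon> t. \<epsilon> > 0 \<Longrightarrow> \<epsilon> \<le> \<bar>t\<bar> \<Longrightarrow> W \<epsilon> t = \<bar>t\<bar> powr (-q)"
  shows "((\<lambda>\<epsilon>. LINT t|lborel. W \<epsilon> t * D t) \<longlongrightarrow>
      (LINT t|lborel. \<bar>t\<bar> powr (-q) * (D t + D (-t))) / 2) (at_right 0)"
proof -
  \<comment> \<open>The weight bound excludes the origin; there the symmetrised difference vanishes
    instead.\<close>
  have S0: "D 0 + D (-0) = 0" using B[of 0] by simp
  \<comment> \<open>The dominated convergence rule is for limits at infinity, hence the substitution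
    of \<open>inverse r\<close> for \<epsilon>.\<close>
  have "((\<lambda>r. LINT t|lborel. W (inverse r) t * (D t + D (-t))) \<longlongrightarrow>
      (LINT t|lborel. \<bar>t\<bar> powr (-q) * (D t + D (-t)))) at_top"
  proof (rule integral_dominated_convergence_at_top)
    show "integrable lborel (\<lambda>t. B * (\<bar>t\<bar> powr (-q) * min (t\<^sup>2) 1))"
      by (intro integrable_mult_right integrable_min_square_powr q)
    show "AE t in lborel. ((\<lambda>r. W (inverse r) t * (D t + D (-t))) \<longlongrightarrow> \<bar>t\<bar> powr (-q) * (D t + D (-t))) at_top"
    proof (rule AE_I2)
      fix t :: real
      show "((\<lambda>r. W (inverse r) t * (D t + D (-t))) \<longlongrightarrow> \<bar>t\<bar> powr (-q) * (D t + D (-t))) at_top"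
      proof (cases "t = 0")
        case True
        then show ?thesis using S0 by simp
      next
        case False
        have "\<forall>\<^sub>F r in at_top. W (inverse r) t * (D t + D (-t)) = \<bar>t\<bar> powr (-q) * (D t + D (-t))"
          using eventually_ge_at_top[of "inverse \<bar>t\<bar>"]
        proof eventually_elim
          case (elim r)
          have "r > 0" using elim False by (smt (verit) positive_imp_inverse_positive)
          moreover have "inverse r \<le> \<bar>t\<bar>"
            using elim False le_imp_inverse_le[OF elim] by simp
          ultimately show ?case using exact[of "inverse r" t] by simp
        qed
        then show ?thesis by (rule tendsto_eventually)
      qed
    qed
    show "\<forall>\<^sub>F r in at_top. AE t in lborel. norm (W (inverse r) t * (D t + D (-t)))
        \<le> B * (\<bar>t\<bar> powr (-q) * min (t\<^sup>2) 1)"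
      using eventually_gt_at_top[of 0]
    proof eventually_elim
      case (elim r)
      show ?case
      proof (rule AE_I2)
        fix t :: real
        show "norm (W (inverse r) t * (D t + D (-t))) \<le> B * (\<bar>t\<bar> powr (-q) * min (t\<^sup>2) 1)"
        proof (cases "t = 0")
          case True
          then show ?thesis using S0 by simp
        next
          case False
          have "\<bar>W (inverse r) t\<bar> * \<bar>D t + D (-t)\<bar> \<le> \<bar>t\<bar> powr (-q) * (B * min (t\<^sup>2) 1)"
            using elim False by (intro mult_mono bound B) auto
          then show ?thesis by (simp add: abs_mult mult_ac)
        qed
      qed
    qed
  qed measurable
  then have lim: "((\<lambda>\<epsilon>. (LINT t|lborel. W \<epsilon> t * (D t + D (-t))) / 2) \<longlongrightarrow>
      (LINT t|lborel. \<bar>t\<bar> powr (-q) * (D t + D (-t))) / 2) (at_right 0)"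
    unfolding filterlim_at_right_to_top by (intro tendsto_divide tendsto_const) auto
  have "(LINT t|lborel. W \<epsilon> t * D t) = (LINT t|lborel. W \<epsilon> t * (D t + D (-t))) / 2" if "\<epsilon> > 0" for \<epsilon>
  proof (rule integral_even_weight)
    show "W \<epsilon> (-t) = W \<epsilon> t" for t by (rule even)
    show "integrable lborel (\<lambda>t. W \<epsilon> t * D t)"
    proof (rule Bochner_Integration.integrable_bound)
      show "integrable lborel (\<lambda>t. M * W \<epsilon> t)"
        by (intro integrable_mult_right int that)
      \<comment> \<open>For each fixed positive \<epsilon>, boundedness of \<open>D\<close> makes
        the product integrable before symmetrisation, so the integral may be split and
        reflected.\<close>
      have "\<bar>W \<epsilon> t\<bar> * \<bar>D t\<bar> \<le> \<bar>W \<epsilon> t\<bar> * \<bar>M\<bar>" for t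
        using M[of t] by (intro mult_left_mono) auto
      then show "AE t in lborel. norm (W \<epsilon> t * D t) \<le> norm (M * W \<epsilon> t)"
        by (intro AE_I2) (simp add: abs_mult mult.commute)
    qed measurable
  qed
  then show ?thesis
    by (intro tendsto_cong[THEN iffD2, OF _ lim] eventually_at_right_less[THEN eventually_mono]) auto
qed

section \<open>Second differences and the normalising constants\<close>

text \<open>A linear map on the real line is multiplication by its value at 1, so evaluating the
  operator-valued derivatives at 1 recovers the ordinary ones.\<close>

lemma C2_fun_real_derivatives:
  fixes w :: "real \<Rightarrow> real"
  assumes "C2_fun w"
  obtains d1 d2 :: "real \<Rightarrow> real"
  where "\<And>x. (w has_real_derivative d1 x) (at x)" "\<And>x. (d1 has_real_derivative d2 x) (at x)"
    "continuous_on UNIV d2"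
proof -
  from assms obtain w' and w'' :: "real \<Rightarrow> real \<Rightarrow>\<^sub>L (real \<Rightarrow>\<^sub>L real)"
    where w: "\<And>x. (w has_derivative blinfun_apply (w' x)) (at x)"
      "\<And>x. (w' has_derivative blinfun_apply (w'' x)) (at x)" and c: "continuous_on UNIV w''"
    unfolding C2_fun_def by auto
  have mult: "blinfun_apply L = (*) (blinfun_apply L 1)" for L :: "real \<Rightarrow>\<^sub>L real"
  proof
    fix h :: real
    have "blinfun_apply L (h *\<^sub>R 1) = h *\<^sub>R blinfun_apply L 1" by (rule blinfun.scaleR_right)
    then show "blinfun_apply L h = blinfun_apply L 1 * h" by (simp add: mult.commute)
  qed
  have ev: "(\<lambda>h. blinfun_apply (blinfun_apply (w'' x) h) 1) = (*) (blinfun_apply (blinfun_apply (w'' x) 1) 1)" for x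
  proof
    fix h :: real
    have "blinfun_apply (w'' x) (h *\<^sub>R 1) = h *\<^sub>R blinfun_apply (w'' x) 1" by (rule blinfun.scaleR_right)
    then show "blinfun_apply (blinfun_apply (w'' x) h) 1 = blinfun_apply (blinfun_apply (w'' x) 1) 1 * h"
      by (simp add: mult.commute blinfun.scaleR_left)
  qed
  show ?thesis
  proof
    show "(w has_real_derivative blinfun_apply (w' x) 1) (at x)" for x
      using w(1)[of x] unfolding has_field_derivative_def by (subst (asm) mult)
    have "((\<lambda>x. blinfun_apply (w' x) 1) has_derivative (\<lambda>h. blinfun_apply (blinfun_apply (w'' x) h) 1)) (at x)" for x
      by (auto intro!: derivative_eq_intros w(2))
    then show "((\<lambda>x. blinfun_apply (w' x) 1) has_real_derivative blinfun_apply (blinfun_apply (w'' x) 1) 1) (at x)" for x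
      unfolding has_field_derivative_def ev .
    show "continuous_on UNIV (\<lambda>x. blinfun_apply (blinfun_apply (w'' x) 1) 1)"
      by (intro continuous_intros c)
  qed
qed

text \<open>Two mean value steps produce a value of the second derivative between
  \<open>x - 1\<close> and \<open>x + 1\<close>, where compactness bounds it by
  \<open>K0\<close>.\<close>

lemma C2_fun_second_difference:
  fixes w :: "real \<Rightarrow> real"
  assumes C2: "C2_fun w"
  obtains K where "K \<ge> 0" "\<And>t. \<bar>t\<bar> \<le> 1 \<Longrightarrow> \<bar>w (x + t) + w (x - t) - 2 * w x\<bar> \<le> K * t\<^sup>2"
proof -
  obtain d1 d2 where d: "\<And>x. (w has_real_derivative d1 x) (at x)"
    "\<And>x. (d1 has_real_derivative d2 x) (at x)" and c: "continuous_on UNIV d2"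
    using C2_fun_real_derivatives[OF C2] by metis
  have "compact (d2 ` {x - 1..x + 1})"
    using continuous_on_subset[OF c] by (intro compact_continuous_image) auto
  then have "bounded (d2 ` {x - 1..x + 1})"
    by (rule compact_imp_bounded)
  then obtain K0 where K0: "\<forall>y\<in>{x - 1..x + 1}. \<bar>d2 y\<bar> \<le> K0"
    unfolding bounded_iff by auto
  then have "K0 \<ge> 0" by (meson abs_ge_zero atLeastAtMost_iff order_trans le_add_same_cancel1 diff_le_eq zero_le_one order_refl)
  have pos: "\<bar>w (x + t) + w (x - t) - 2 * w x\<bar> \<le> 2 * K0 * t\<^sup>2" if "0 < t" "t \<le> 1" for t
  proof -
    \<comment> \<open>The first step applies to the even function
      \<open>w (x + t) + w (x - t)\<close> of \<open>t\<close>. The second acts on an interval of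
      length \<open>2 * z\<close>, which is the origin of the factor 2 in the final
      constant.\<close>
    have "\<exists>z. 0 < z \<and> z < t \<and> (w (x + t) + w (x - t)) - (w (x + 0) + w (x - 0)) = (t - 0) * (d1 (x + z) - d1 (x - z))"
      using that by (intro MVT2) (auto intro!: derivative_eq_intros DERIV_chain2[OF d(1)])
    then obtain z where z: "0 < z" "z < t" "w (x + t) + w (x - t) - 2 * w x = t * (d1 (x + z) - d1 (x - z))"
      by auto
    have "\<exists>y. x - z < y \<and> y < x + z \<and> d1 (x + z) - d1 (x - z) = ((x + z) - (x - z)) * d2 y"
      using z by (intro MVT2 d(2)) auto
    then obtain y where y: "x - z < y" "y < x + z" "d1 (x + z) - d1 (x - z) = 2 * z * d2 y"
      by auto
    have "\<bar>d2 y\<bar> \<le> K0" using K0 y z that by auto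
    then have "z * \<bar>d2 y\<bar> \<le> t * K0" using z by (intro mult_mono) auto
    then have "t * (2 * (z * \<bar>d2 y\<bar>)) \<le> t * (2 * (t * K0))" using that by (intro mult_left_mono) auto
    then show ?thesis
      using z(1) that unfolding z(3) y(3) by (simp add: abs_mult power2_eq_square mult_ac)
  qed
  show ?thesis
  proof
    show "2 * K0 \<ge> 0" using \<open>K0 \<ge> 0\<close> by simp
    fix t :: real assume t: "\<bar>t\<bar> \<le> 1"
    consider "t = 0" | "t > 0" | "t < 0" by linarith
    then show "\<bar>w (x + t) + w (x - t) - 2 * w x\<bar> \<le> 2 * K0 * t\<^sup>2"
    proof cases
      case 3
      then show ?thesis using pos[of "-t"] t by (simp add: add.commute)
    qed (use t pos in auto)
  qed
qed

text \<open>The slicing factor for the exponent \<open>3 + 2 * s\<close> exactly compensates the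
  change of dimension: the Gamma recurrence contributes \<open>(1 + 2 * s) / 2\<close> and the
  powers of \<open>pi\<close> one factor \<open>pi\<close>.\<close>

lemma frac_const_3:
  fixes s :: real
  assumes "0 < s" "s < 1"
  shows "frac_const 3 s * (2 * pi / (1 + 2 * s)) = frac_const 1 s"
proof -
  have "Gamma (s + 1 / 2 + 1) = (s + 1 / 2) * Gamma (s + 1 / 2)"
    using assms by (intro Gamma_plus1) (auto elim!: nonpos_Ints_cases)
  then have G: "Gamma (3 / 2 + s) = (1 + 2 * s) / 2 * Gamma (1 / 2 + s)"
    by (simp add: field_simps)
  have P: "pi powr (3 / 2) = pi * pi powr (1 / 2)"
    using powr_add[of pi 1 "1/2"] by simp
  show ?thesis
    unfolding frac_const_def of_nat_numeral of_nat_1 G P using assms by (simp add: divide_simps)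
qed

section \<open>Plane waves\<close>

text \<open>Both truncated integrals are shown to converge, to multiples of the same absolutely
  convergent integral \<open>L\<close>; only then can the operator \<open>Lim\<close> be
  evaluated.\<close>

lemma frac_laplacian_ridge:
  fixes \<phi> :: "real \<Rightarrow> real" and e X :: "real^3"
  assumes s: "0 < s" "s < 1" and C2: "C2_fun \<phi>" and M: "\<And>x. \<bar>\<phi> x\<bar> \<le> M" and e: "norm e = 1"
  shows "frac_laplacian s (\<lambda>X. \<phi> (e \<bullet> X)) X = frac_laplacian s \<phi> (e \<bullet> X)"
proof -
  define \<mu> where "\<mu> = e \<bullet> X"
  define q where "q = 1 + 2 * s"
  define D where "D = (\<lambda>t. \<phi> \<mu> - \<phi> (\<mu> + t))"
  define L where "L = (LINT t|lborel. \<bar>t\<bar> powr (-q) * (D t + D (-t))) / 2"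
  have q: "1 < q" "q < 3" using s by (auto simp: q_def)
  have cont: "continuous_on UNIV \<phi>"
    using C2_fun_real_derivatives[OF C2] by (metis DERIV_isCont continuous_at_imp_continuous_on)
  have D_meas [measurable]: "D \<in> borel_measurable borel"
    unfolding D_def
    by (intro borel_measurable_continuous_onI continuous_intros continuous_on_compose2[OF cont]) auto
  have D_bound: "\<bar>D t\<bar> \<le> 2 * M" for t
    using M[of \<mu>] M[of "\<mu> + t"] by (auto simp: D_def)
  obtain K where K: "K \<ge> 0" "\<And>t. \<bar>t\<bar> \<le> 1 \<Longrightarrow> \<bar>\<phi> (\<mu> + t) + \<phi> (\<mu> - t) - 2 * \<phi> \<mu>\<bar> \<le> K * t\<^sup>2"
    using C2_fun_second_difference[OF C2] by metis
  \<comment> \<open>Up to distance 1 the quadratic estimate with \<open>K\<close> applies; beyond it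
    each of the two differences is at most \<open>2 * M\<close>.\<close>
  have S_bound: "\<bar>D t + D (-t)\<bar> \<le> max K (4 * M) * min (t\<^sup>2) 1" for t
  proof (cases "\<bar>t\<bar> \<le> 1")
    case True
    have "\<bar>D t + D (-t)\<bar> \<le> K * t\<^sup>2"
      using K(2)[OF True] by (simp add: D_def abs_minus_commute algebra_simps)
    also have "\<dots> \<le> max K (4 * M) * t\<^sup>2"
      by (intro mult_right_mono) auto
    also have "t\<^sup>2 = min (t\<^sup>2) 1"
      using True by (simp add: abs_square_le_1 min_def)
    finally show ?thesis .
  next
    case False
    then have "min (t\<^sup>2) 1 = 1"
      using abs_square_le_1[of t] by (simp add: min_def)
    then show ?thesis
      using D_bound[of t] D_bound[of "-t"] by simp
  qed
  note lim = tendsto_regularised_integral[OF q D_meas D_bound S_bound]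
  have ind_even: "indicator {t. \<epsilon> \<le> \<bar>t\<bar>} (-t) = (indicator {t. \<epsilon> \<le> \<bar>t\<bar>} t :: real)" for \<epsilon> t :: real
    by (simp add: indicator_def)
  \<comment> \<open>The sharp cut-off belongs to the line itself; the maximum in \<open>lim3\<close>
    is what slicing the cut-off in space leaves behind.\<close>
  have lim1: "((\<lambda>\<epsilon>. LINT t|lborel. indicator {t. \<epsilon> \<le> \<bar>t\<bar>} t * \<bar>t\<bar> powr (-q) * D t) \<longlongrightarrow> L) (at_right 0)"
    unfolding L_def by (rule lim) (use q in \<open>auto simp: ind_even intro!: integrable_truncated_powr\<close>)
  have lim3: "((\<lambda>\<epsilon>. LINT t|lborel. max \<bar>t\<bar> \<epsilon> powr (-q) * D t) \<longlongrightarrow> L) (at_right 0)"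
    unfolding L_def by (rule lim) (use q in \<open>auto simp: integrable_max_powr intro!: powr_mono2'\<close>)
  have eq1: "(LINT \<xi>:{\<xi>. \<epsilon> \<le> norm \<xi>}|lborel. (\<phi> \<mu> - \<phi> (\<mu> + \<xi>)) / norm \<xi> powr (real DIM(real) + 2 * s))
      = (LINT t|lborel. indicator {t. \<epsilon> \<le> \<bar>t\<bar>} t * \<bar>t\<bar> powr (-q) * D t)" for \<epsilon>
    unfolding set_lebesgue_integral_def
    by (intro Bochner_Integration.integral_cong) (simp_all add: D_def powr_minus divide_inverse flip: q_def)
  have eq3: "(LINT \<xi>:{\<xi>. \<epsilon> \<le> norm \<xi>}|lborel.
        (\<phi> (e \<bullet> X) - \<phi> (e \<bullet> (X + \<xi>))) / norm \<xi> powr (real DIM(real^3) + 2 * s))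
      = 2 * pi / q * (LINT t|lborel. max \<bar>t\<bar> \<epsilon> powr (-q) * D t)" if "\<epsilon> > 0" for \<epsilon>
    using ridge_truncated_integral[OF e that _ D_meas, of "3 + 2 * s"] s
    by (simp add: D_def \<mu>_def q_def inner_add_right)
  have "((\<lambda>\<epsilon>. LINT \<xi>:{\<xi>. \<epsilon> \<le> norm \<xi>}|lborel.
        (\<phi> (e \<bullet> X) - \<phi> (e \<bullet> (X + \<xi>))) / norm \<xi> powr (real DIM(real^3) + 2 * s)) \<longlongrightarrow> 2 * pi / q * L) (at_right 0)"
    by (rule tendsto_cong[THEN iffD2, OF _ tendsto_mult[OF tendsto_const lim3]])
      (rule eventually_at_right_less[THEN eventually_mono], rule eq3)
  then have "frac_laplacian s (\<lambda>X. \<phi> (e \<bullet> X)) X = frac_const 3 s * (2 * pi / q * L)"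
    unfolding frac_laplacian_def by (subst tendsto_Lim) auto
  also have "\<dots> = frac_const 1 s * L"
    by (simp only: frac_const_3[OF s, symmetric] q_def mult.assoc)
  also have "\<dots> = frac_laplacian s \<phi> \<mu>"
    unfolding frac_laplacian_def eq1 using tendsto_Lim[OF _ lim1] by simp
  finally show ?thesis by (simp add: \<mu>_def)
qed

lemma C2_fun_ridge:
  fixes \<phi> :: "real \<Rightarrow> real" and e :: "'a::euclidean_space"
  assumes "C2_fun \<phi>"
  shows "C2_fun (\<lambda>X. \<phi> (e \<bullet> X))"
proof -
  obtain d1 d2 where d: "\<And>x. (\<phi> has_real_derivative d1 x) (at x)"
    "\<And>x. (d1 has_real_derivative d2 x) (at x)" and c: "continuous_on UNIV d2"
    using C2_fun_real_derivatives[OF assms] by metis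
  define E where "E = blinfun_inner_left e"
  \<comment> \<open>\<open>G\<close> is the rank-one bilinear form sending \<open>h\<close> to
    \<open>(e \<bullet> h) *\<^sub>R E\<close>. The second derivative of the plane wave is a scalar
    multiple of it, so its continuity reduces to that of \<open>d2\<close>.\<close>
  define G where "G = (blinfun_scaleR_left E) o\<^sub>L E"
  have E: "blinfun_apply E h = e \<bullet> h" for h
    by (simp add: E_def inner_commute)
  have inner: "((\<lambda>X. e \<bullet> X) has_derivative (\<lambda>h. e \<bullet> h)) (at X)" for X
    by (auto intro!: derivative_eq_intros)
  show ?thesis
    unfolding C2_fun_def
  proof (intro exI conjI allI)
    fix X
    have "((\<lambda>X. \<phi> (e \<bullet> X)) has_derivative (\<lambda>h. d1 (e \<bullet> X) * (e \<bullet> h))) (at X)"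
      using has_derivative_compose[OF inner, of \<phi> "(*) (d1 (e \<bullet> X))"] d(1)[of "e \<bullet> X"]
      by (simp add: has_field_derivative_def)
    moreover have "blinfun_apply (d1 (e \<bullet> X) *\<^sub>R E) = (\<lambda>h. d1 (e \<bullet> X) * (e \<bullet> h))"
      by (simp add: fun_eq_iff E blinfun.scaleR_left)
    ultimately show "((\<lambda>X. \<phi> (e \<bullet> X)) has_derivative blinfun_apply (d1 (e \<bullet> X) *\<^sub>R E)) (at X)"
      by simp
    have d1: "((\<lambda>X. d1 (e \<bullet> X)) has_derivative (\<lambda>h. d2 (e \<bullet> X) * (e \<bullet> h))) (at X)"
      using has_derivative_compose[OF inner, of d1 "(*) (d2 (e \<bullet> X))"] d(2)[of "e \<bullet> X"]
      by (simp add: has_field_derivative_def)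
    have "((\<lambda>X. d1 (e \<bullet> X) *\<^sub>R E) has_derivative (\<lambda>h. (d2 (e \<bullet> X) * (e \<bullet> h)) *\<^sub>R E)) (at X)"
      using has_derivative_scaleR_left[OF d1] .
    moreover have "blinfun_apply (d2 (e \<bullet> X) *\<^sub>R G) = (\<lambda>h. (d2 (e \<bullet> X) * (e \<bullet> h)) *\<^sub>R E)"
      by (simp add: fun_eq_iff G_def E blinfun.scaleR_left)
    ultimately show "((\<lambda>X. d1 (e \<bullet> X) *\<^sub>R E) has_derivative blinfun_apply (d2 (e \<bullet> X) *\<^sub>R G)) (at X)"
      by simp
  next
    show "continuous_on UNIV (\<lambda>X. d2 (e \<bullet> X) *\<^sub>R G)"
      by (intro continuous_intros continuous_on_compose2[OF c]) auto
  qed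
qed

lemma frechet_derivative_ridge:
  fixes \<phi> :: "real \<Rightarrow> real" and e X v :: "'a::real_inner"
  assumes "\<phi> differentiable at (e \<bullet> X)"
  shows "frechet_derivative (\<lambda>X. \<phi> (e \<bullet> X)) (at X) v = deriv \<phi> (e \<bullet> X) * (e \<bullet> v)"
proof -
  have "(\<phi> has_derivative (*) (deriv \<phi> (e \<bullet> X))) (at (e \<bullet> X))"
    using assms by (simp add: DERIV_deriv_iff_real_differentiable flip: has_field_derivative_def)
  moreover have "((\<lambda>X. e \<bullet> X) has_derivative (\<lambda>h. e \<bullet> h)) (at X)"
    by (auto intro!: derivative_eq_intros)
  ultimately have "((\<lambda>X. \<phi> (e \<bullet> X)) has_derivative (\<lambda>h. deriv \<phi> (e \<bullet> X) * (e \<bullet> h))) (at X)"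
    by (rule has_derivative_compose[rotated])
  from frechet_derivative_at[OF this] show ?thesis by metis
qed

section \<open>The pyramid as a maximum of plane waves\<close>

lemma antimono_between_limits:
  fixes \<phi> :: "real \<Rightarrow> real"
  assumes anti: "antimono \<phi>" and top: "(\<phi> \<longlongrightarrow> l) at_top" and bot: "(\<phi> \<longlongrightarrow> u) at_bot"
  shows "l \<le> \<phi> x \<and> \<phi> x \<le> u"
proof
  show "l \<le> \<phi> x"
    by (rule tendsto_upperbound[OF top])
      (auto intro!: eventually_at_top_linorderI[of x] antimonoD[OF anti])
  show "\<phi> x \<le> u"
    by (rule tendsto_lowerbound[OF bot])
      (auto intro!: eventually_at_bot_linorderI[of x] antimonoD[OF anti])
qed

lemma continuous_on_MAX:
  fixes h :: "'i \<Rightarrow> 'a::topological_space \<Rightarrow> 'b::linorder_topology"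
  assumes "finite J" "J \<noteq> {}" "\<And>j. j \<in> J \<Longrightarrow> continuous_on S (h j)"
  shows "continuous_on S (\<lambda>x. MAX j\<in>J. h j x)"
  using assms by (induction rule: finite_ne_induct) (auto intro!: continuous_on_max)

theorem proposition3p1:
  fixes s k c :: real and f \<Phi> :: "real \<Rightarrow> real"
    and N :: nat and a b :: "nat \<Rightarrow> real"
  assumes "1 / 2 < s" and "s < 1"
    and "bistable f"
    and "profile s f k \<Phi>" and "k > 0"
    and "c > k"
    and "pyramid_data (sqrt (c\<^sup>2 - k\<^sup>2) / k) N a b"
  shows "sub_solution s c f
           (\<lambda>X :: real^3. \<Phi> (k / c * (X $ 3 - pyramid N a b (X $ 1) (X $ 2))))"
proof -
  have C2: "C2_fun \<Phi>"
    and eq: "frac_laplacian s \<Phi> \<mu> - k * deriv \<Phi> \<mu> - f (\<Phi> \<mu>) = 0"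
    and neg: "deriv \<Phi> \<mu> < 0"
    and top: "(\<Phi> \<longlongrightarrow> -1) at_top" and bot: "(\<Phi> \<longlongrightarrow> 1) at_bot" for \<mu>
    using \<open>profile s f k \<Phi>\<close> by (auto simp: profile_def)
  have diff: "\<Phi> differentiable at x" for x
    using C2 unfolding C2_fun_def differentiable_def by blast
  have DERIV: "(\<Phi> has_real_derivative deriv \<Phi> x) (at x)" for x
    using diff by (simp add: DERIV_deriv_iff_real_differentiable)
  have anti: "antimono \<Phi>"
  proof (rule antimonoI)
    show "\<Phi> y \<le> \<Phi> x" if "x \<le> y" for x y
      using that DERIV_nonpos_imp_nonincreasing[OF that, of \<Phi>] DERIV neg less_imp_le by metis
  qed
  have bound: "\<bar>\<Phi> x\<bar> \<le> 1" for x
    using antimono_between_limits[OF anti top bot, of x] by auto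
  have cont: "continuous_on S \<Phi>" for S
    using DERIV by (meson DERIV_isCont continuous_at_imp_continuous_on)
  have ab: "(a j)\<^sup>2 + (b j)\<^sup>2 = (sqrt (c\<^sup>2 - k\<^sup>2) / k)\<^sup>2" if "j \<in> {1..N}" for j
    using assms(7) that by (auto simp: pyramid_data_def)
  have N: "{1..N} \<noteq> {}" using assms(7) by (auto simp: pyramid_data_def)
  have ck: "c > 0" "c\<^sup>2 - k\<^sup>2 \<ge> 0"
    using \<open>k > 0\<close> \<open>c > k\<close> by (auto intro!: power_mono)
  \<comment> \<open>The graph of each face has normal \<open>vector [- a j, - b j, 1]\<close>, of
    squared length \<open>1 + (c\<^sup>2 - k\<^sup>2) / k\<^sup>2 = c\<^sup>2 / k\<^sup>2\<close>;
    the factor \<open>k / c\<close> normalises it.\<close>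
  define e :: "nat \<Rightarrow> real^3" where "e j = (k / c) *\<^sub>R vector [- a j, - b j, 1]" for j
  have inner_e: "e j \<bullet> X = k / c * (X $ 3 - (a j * X $ 1 + b j * X $ 2))" for j X
    by (simp add: e_def inner_vec_def sum_3 algebra_simps)
  have norm_e: "norm (e j) = 1" if "j \<in> {1..N}" for j
  proof -
    have "e j \<bullet> e j = (k / c)\<^sup>2 * (1 + ((a j)\<^sup>2 + (b j)\<^sup>2))"
      by (simp add: e_def inner_vec_def sum_3 power2_eq_square algebra_simps)
    also have "\<dots> = 1"
      using ck \<open>k > 0\<close> by (simp add: ab[OF that] power_divide field_simps)
    finally show ?thesis by (simp add: norm_eq_1)
  qed
  have op: "travelling_op s c f (\<lambda>X. \<Phi> (e j \<bullet> X)) X = 0" if "j \<in> {1..N}" for j X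
  proof -
    \<comment> \<open>The vertical component of \<open>e j\<close> is \<open>k / c\<close>, so the
      drift with speed \<open>c\<close> in space becomes the drift with speed \<open>k\<close> in
      the profile equation.\<close>
    have "c * (e j \<bullet> axis 3 1) = k"
      using ck by (simp add: e_def inner_axis)
    then have "c * frechet_derivative (\<lambda>X. \<Phi> (e j \<bullet> X)) (at X) (axis 3 1) = k * deriv \<Phi> (e j \<bullet> X)"
      by (simp add: frechet_derivative_ridge[OF diff] mult.left_commute mult.commute)
    moreover have "frac_laplacian s (\<lambda>X. \<Phi> (e j \<bullet> X)) X = frac_laplacian s \<Phi> (e j \<bullet> X)"
      using assms(1,2) by (intro frac_laplacian_ridge[OF _ _ C2 bound norm_e[OF that]]) auto
    ultimately show ?thesis
      using eq[of "e j \<bullet> X"] by (simp add: travelling_op_def)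
  qed
  let ?v = "\<lambda>X :: real^3. \<Phi> (k / c * (X $ 3 - pyramid N a b (X $ 1) (X $ 2)))"
  define V where "V = (\<lambda>j X. \<Phi> (e j \<bullet> X)) ` {1..N}"
  have max: "?v X = (MAX w\<in>V. w X)" for X
  proof -
    let ?h = "\<lambda>j. a j * X $ 1 + b j * X $ 2"
    \<comment> \<open>The height enters with a minus sign and \<Phi> is decreasing. The two
      reversals give an increasing function of the height, which commutes with the maximum over the
      faces.\<close>
    have mono: "mono (\<lambda>h. \<Phi> (k / c * (X $ 3 - h)))"
      using \<open>k > 0\<close> ck by (intro monoI antimonoD[OF anti] mult_left_mono) auto
    have "?v X = \<Phi> (k / c * (X $ 3 - Max (?h ` {1..N})))"
      by (simp add: pyramid_def)
    also have "\<dots> = Max ((\<lambda>h. \<Phi> (k / c * (X $ 3 - h))) ` ?h ` {1..N})"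
      using N by (intro mono_Max_commute[OF mono]) auto
    also have "\<dots> = (MAX w\<in>V. w X)"
      by (simp add: V_def image_image inner_e)
    finally show ?thesis .
  qed
  show ?thesis
    unfolding sub_solution_def
  proof (intro conjI exI)
    have "continuous_on UNIV (\<lambda>X :: real^3. MAX j\<in>{1..N}. a j * X $ 1 + b j * X $ 2)"
      using N by (intro continuous_on_MAX continuous_intros) auto
    then show "continuous_on UNIV ?v"
      unfolding pyramid_def by (intro continuous_on_compose2[OF cont[of UNIV]] continuous_intros) auto
    show "bounded (range ?v)"
      using bound by (auto simp: bounded_iff)
    show "finite V" "V \<noteq> {}" using N by (auto simp: V_def)
    show "\<forall>w\<in>V. C2_fun w \<and> bounded (range w) \<and> (\<forall>X. travelling_op s c f w X \<le> 0)"
      using bound by (auto simp: V_def op bounded_iff intro!: C2_fun_ridge[OF C2])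
    show "\<forall>X. ?v X = (MAX w\<in>V. w X)" using max by blast
  qed
qed

end
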